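(* Algorithm N (described in the context) always succeeds, that is, every execution of step ( * ) can be carried out and the final output is a nonoverlapping weakly infeasible SDP instance; and every nonoverlapping weakly infeasible SDP instance is among its possible outputs.
   Context: $\mathcal{S}^n$ is the space of real symmetric $n\times n$ matrices with $a\bullet b=\mathrm{trace}(ab)$; $\mathcal{S}^n_+$ is the cone of positive semidefinite ones. An SDP instance is a system $a_i\bullet y=c_i\ (i=1,\dots,m),\ y\succeq0$, with $a_i\in\mathcal{S}^n$, $c\in\mathbb{R}^m$; write $Ax=\sum_{i=1}^m x_ia_i$ and $A^*y=(a_1\bullet y,\dots,a_m\bullet y)^T$. It is a standing assumption that the operator $A$ of every SDP instance considered (including the output of the algorithm below) is injective, i.e., $a_1,\dots,a_m$ are linearly independent. $\mathrm{REGFR}_k(\mathcal{S}^n_+)$, block sizes $p_1,\dots,p_k\ge0$: sequences $(y_1,\dots,y_k)$ in $\mathcal{S}^n$ such that, partitioning rows and columns into consecutive groups of sizes $p_1+\dots+p_{i-1}$, $p_i$, $n-p_1-\dots-p_i$, $$y_i=\begin{pmatrix}\times&\times&\times\\ \times&I&0\\ \times&0&0\end{pmatrix}.$$ $\mathrm{REVREGFR}_\ell(\mathcal{S}^n_+)$, block sizes $q_1,\dots,q_\ell\ge0$: sequences $(y_1,\dots,y_\ell)$ in $\mathcal{S}^n$ such that, partitioning into consecutive groups of sizes $n-q_1-\dots-q_j$, $q_j$, $q_1+\dots+q_{j-1}$, $$y_j=\begin{pmatrix}0&0&\times\\ 0&I&\times\\ \times&\times&\times\end{pmatrix}.$$ Here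 $\times$ denotes arbitrary blocks. An SDP instance is nonoverlapping weakly infeasible if, for some $k$ with $1\le k\le n$ and $k+1\le m$, and some $\ell$ with $0\le\ell\le n$: (a) $(a_1,\dots,a_{k+1})\in\mathrm{REGFR}_{k+1}(\mathcal{S}^n_+)$, and $c_1=\dots=c_k=0$, $c_{k+1}=-1$; (b) there is $(y_1,\dots,y_{\ell+1})\in\mathrm{REVREGFR}_{\ell+1}(\mathcal{S}^n_+)$ such that $A^*y_j=0$ $(j=1,\dots,\ell)$ and $A^*y_{\ell+1}=c$; (c) the block sizes $p_i$ of $(a_1,\dots,a_{k+1})$ and $q_j$ of $(y_1,\dots,y_{\ell+1})$ satisfy $\sum_{i=1}^{k+1}p_i+\sum_{j=1}^{\ell+1}q_j\le n$. Index blocks: $P_1=\{1,\dots,p_1\}$, $P_2=\{p_1+1,\dots,p_1+p_2\}$, etc.; $Q_1=\{n-q_1+1,\dots,n\}$, $Q_2=\{n-q_1-q_2+1,\dots,n-q_1\}$, etc. For $a\in\mathcal{S}^n$ and index sets $P,Q$, $a(P,Q)$ denotes the block of $a$ with rows $P$ and columns $Q$ together with the symmetric block; $a(P,:)=a(P,\{1,\dots,n\})$. Algorithm N (nondeterministic): 1. Choose integers $m,n,k,\ell,p_1,\dots,p_k,q_1,\dots,q_\ell>0$ and $p_{k+1},q_{\ell+1}\ge0$ with $k+1\le m$ and $\sum_{i=1}^{k+1}p_i+\sum_{j=1}^{\ell+1}q_j\le n$. 2. Let $(a_1,\dots,a_{k+1})\in\mathrm{REGFR}_{k+1}(\mathcal{S}^n_+)$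 have block sizes $p_1,\dots,p_{k+1}$ and $(y_1,\dots,y_{\ell+1})\in\mathrm{REVREGFR}_{\ell+1}(\mathcal{S}^n_+)$ have block sizes $q_1,\dots,q_{\ell+1}$. Thus $a_i(P_i,P_i)=I$, $y_j(Q_j,Q_j)=I$, and apart from these blocks only the entries in $a_i(P_1\cup\dots\cup P_{i-1},:)$ and $y_j(Q_1\cup\dots\cup Q_{j-1},:)$ may be nonzero. Fix these latter entries to arbitrary values, except for the entries in $a_i(P_{i-1},Q_1\cup\dots\cup Q_\ell)$ $(i\ge2)$ and $y_j(Q_{j-1},P_1\cup\dots\cup P_k)$ $(j\ge2)$, which are left free. 3. For $i=2,\dots,k+1$, and for $j=2,\dots,\ell+1$ (inner loop): ( * ) set $a_i(P_{i-1},Q_{j-1})$ and $y_j(P_{i-1},Q_{j-1})$ to satisfy the equation $a_i\bullet y_j=0$ if $(i,j)\ne(k+1,\ell+1)$, and $a_i\bullet y_j=-1$ if $(i,j)=(k+1,\ell+1)$. 4. Find $a_{k+2},\dots,a_m\in\mathcal{S}^n$ orthogonal to $y_1,\dots,y_\ell$. 5. Set $c=(0,\dots,0,-1,a_{k+2}\bullet y_{\ell+1},\dots,a_m\bullet y_{\ell+1})^T$ (with $-1$ in position $k+1$) and output the SDP instance given by $a_1,\dots,a_m$ and $c$.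
   Formalization: As stated, completeness fails when some p_i = 0 with i ≤ k, since the algorithm requires p_1,…,p_k > 0. It is proved for instances admitting block sizes with p_1,…,p_k > 0, and for all nonoverlapping weakly infeasible instances up to reordering of the equations. *)

theory Defs
  imports Jordan_Normal_Form.Matrix "HOL-Combinatorics.Permutations"
begin

text \<open>Sequences \<open>a\<^sub>1, a\<^sub>2, \<dots>\<close>, \<open>c\<^sub>1, c\<^sub>2, \<dots>\<close> are functions on \<open>nat\<close> indexed
  from 1, of which only the entries in the stated range matter.  Rows and columns of matrices are
  numbered \<open>0, \<dots>, n - 1\<close>, so all index blocks are shifted down by one.\<close>

definition sym_mats :: "nat \<Rightarrow> real mat set" where
  "sym_mats n = {a \<in> carrier_mat n n. transpose_mat a = a}"

definition mat_trace :: "real mat \<Rightarrow> real" where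
  "mat_trace a = (\<Sum>r<dim_row a. a $$ (r, r))"

definition ip :: "real mat \<Rightarrow> real mat \<Rightarrow> real" where
  "ip a b = mat_trace (a * b)"

definition sdp_op :: "nat \<Rightarrow> nat \<Rightarrow> (nat \<Rightarrow> real mat) \<Rightarrow> (nat \<Rightarrow> real) \<Rightarrow> real mat" where
  "sdp_op m n a x = mat n n (\<lambda>rs. \<Sum>i=1..m. x i * a i $$ rs)"

text \<open>The instance \<open>a\<^sub>i \<bullet> y = c\<^sub>i (i = 1, \<dots>, m), y \<succeq> 0\<close> is given by \<open>m\<close>, \<open>n\<close>, \<open>a\<close> and \<open>c\<close>.  The
  injectivity of \<open>x \<mapsto> \<Sum>\<^sub>i x\<^sub>i a\<^sub>i\<close> is required of every instance; \<open>\<real>\<^sup>m\<close> is represented by the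
  extensional functions on \<open>{1..m}\<close>.\<close>

definition sdp_instance :: "nat \<Rightarrow> nat \<Rightarrow> (nat \<Rightarrow> real mat) \<Rightarrow> (nat \<Rightarrow> real) \<Rightarrow> bool" where
  "sdp_instance m n a c \<longleftrightarrow>
     (\<forall>i\<in>{1..m}. a i \<in> sym_mats n) \<and> inj_on (sdp_op m n a) ({1..m} \<rightarrow>\<^sub>E UNIV)"

definition P_block :: "(nat \<Rightarrow> nat) \<Rightarrow> nat \<Rightarrow> nat set" where
  "P_block p i = {(\<Sum>u=1..<i. p u) ..< (\<Sum>u=1..i. p u)}"

definition Q_block :: "nat \<Rightarrow> (nat \<Rightarrow> nat) \<Rightarrow> nat \<Rightarrow> nat set" where
  "Q_block n q j = {n - (\<Sum>v=1..j. q v) ..< n - (\<Sum>v=1..<j. q v)}"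

text \<open>Among the rows and columns from \<open>p\<^sub>1 + \<dots> + p\<^sub>i\<^sub>-\<^sub>1\<close> on, \<open>y\<^sub>i\<close> is the identity on block \<open>P\<^sub>i\<close> and
  zero elsewhere; the other entries are arbitrary.  The predicate \<open>revregfr\<close> is the mirror image.\<close>

definition regfr :: "nat \<Rightarrow> nat \<Rightarrow> (nat \<Rightarrow> nat) \<Rightarrow> (nat \<Rightarrow> real mat) \<Rightarrow> bool" where
  "regfr n k p y \<longleftrightarrow> (\<Sum>i=1..k. p i) \<le> n \<and>
     (\<forall>i\<in>{1..k}. y i \<in> sym_mats n \<and>
        (\<forall>r\<in>{(\<Sum>u=1..<i. p u)..<n}. \<forall>s\<in>{(\<Sum>u=1..<i. p u)..<n}.
           y i $$ (r, s) = (if r = s \<and> r \<in> P_block p i then 1 else 0)))"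

definition revregfr :: "nat \<Rightarrow> nat \<Rightarrow> (nat \<Rightarrow> nat) \<Rightarrow> (nat \<Rightarrow> real mat) \<Rightarrow> bool" where
  "revregfr n l q y \<longleftrightarrow> (\<Sum>j=1..l. q j) \<le> n \<and>
     (\<forall>j\<in>{1..l}. y j \<in> sym_mats n \<and>
        (\<forall>r\<in>{..<n - (\<Sum>v=1..<j. q v)}. \<forall>s\<in>{..<n - (\<Sum>v=1..<j. q v)}.
           y j $$ (r, s) = (if r = s \<and> r \<in> Q_block n q j then 1 else 0)))"

definition nonoverlapping_witness ::
  "nat \<Rightarrow> nat \<Rightarrow> (nat \<Rightarrow> real mat) \<Rightarrow> (nat \<Rightarrow> real) \<Rightarrow>
   nat \<Rightarrow> nat \<Rightarrow> (nat \<Rightarrow> nat) \<Rightarrow> (nat \<Rightarrow> nat) \<Rightarrow> (nat \<Rightarrow> real mat) \<Rightarrow> bool" where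
  "nonoverlapping_witness m n a c k l p q y \<longleftrightarrow>
     1 \<le> k \<and> k \<le> n \<and> k + 1 \<le> m \<and> l \<le> n \<and>
     regfr n (k + 1) p a \<and> (\<forall>i\<in>{1..k}. c i = 0) \<and> c (k + 1) = -1 \<and>
     revregfr n (l + 1) q y \<and>
     (\<forall>j\<in>{1..l}. \<forall>i\<in>{1..m}. ip (a i) (y j) = 0) \<and>
     (\<forall>i\<in>{1..m}. ip (a i) (y (l + 1)) = c i) \<and>
     (\<Sum>i=1..k+1. p i) + (\<Sum>j=1..l+1. q j) \<le> n"

definition nonoverlapping_weakly_infeasible ::
  "nat \<Rightarrow> nat \<Rightarrow> (nat \<Rightarrow> real mat) \<Rightarrow> (nat \<Rightarrow> real) \<Rightarrow> bool" where
  "nonoverlapping_weakly_infeasible m n a c \<longleftrightarrow> sdp_instance m n a c \<and>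
     (\<exists>k l p q y. nonoverlapping_witness m n a c k l p q y)"

definition alg_params ::
  "nat \<Rightarrow> nat \<Rightarrow> nat \<Rightarrow> nat \<Rightarrow> (nat \<Rightarrow> nat) \<Rightarrow> (nat \<Rightarrow> nat) \<Rightarrow> bool" where
  "alg_params m n k l p q \<longleftrightarrow>
     m > 0 \<and> n > 0 \<and> k > 0 \<and> l > 0 \<and> (\<forall>i\<in>{1..k}. p i > 0) \<and> (\<forall>j\<in>{1..l}. q j > 0) \<and>
     k + 1 \<le> m \<and> (\<Sum>i=1..k+1. p i) + (\<Sum>j=1..l+1. q j) \<le> n"

text \<open>The working state consists of the two matrix sequences.  The entries that are left free
  at first, namely those in \<open>a\<^sub>i(P\<^sub>i\<^sub>-\<^sub>1, Q\<^sub>1 \<union> \<dots> \<union> Q\<^sub>l)\<close> and \<open>y\<^sub>j(Q\<^sub>j\<^sub>-\<^sub>1, P\<^sub>1 \<union> \<dots> \<union> P\<^sub>k)\<close>, hold unconstrained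
  placeholder values in the initial state; the loop overwrites every one of them.  All other
  entries keep the value chosen initially.\<close>

type_synonym alg_state = "(nat \<Rightarrow> real mat) \<times> (nat \<Rightarrow> real mat)"

definition alg_init ::
  "nat \<Rightarrow> nat \<Rightarrow> nat \<Rightarrow> (nat \<Rightarrow> nat) \<Rightarrow> (nat \<Rightarrow> nat) \<Rightarrow> alg_state \<Rightarrow> bool" where
  "alg_init n k l p q s \<longleftrightarrow> regfr n (k + 1) p (fst s) \<and> revregfr n (l + 1) q (snd s)"

definition set_block :: "nat \<Rightarrow> nat set \<Rightarrow> nat set \<Rightarrow> real mat \<Rightarrow> real mat \<Rightarrow> bool" where
  "set_block n P Q b b' \<longleftrightarrow> b' \<in> sym_mats n \<and>
     (\<forall>r<n. \<forall>s<n. (r, s) \<notin> P \<times> Q \<union> Q \<times> P \<longrightarrow> b' $$ (r, s) = b $$ (r, s))"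

definition star_step ::
  "nat \<Rightarrow> nat \<Rightarrow> nat \<Rightarrow> (nat \<Rightarrow> nat) \<Rightarrow> (nat \<Rightarrow> nat) \<Rightarrow> nat \<times> nat \<Rightarrow> alg_state \<Rightarrow> alg_state \<Rightarrow> bool"
  where
  "star_step n k l p q ij s s' \<longleftrightarrow> (case ij of (i, j) \<Rightarrow> case s of (a, y) \<Rightarrow>
     \<exists>b z. set_block n (P_block p (i - 1)) (Q_block n q (j - 1)) (a i) b \<and>
           set_block n (P_block p (i - 1)) (Q_block n q (j - 1)) (y j) z \<and>
           ip b z = (if (i, j) = (k + 1, l + 1) then -1 else 0) \<and>
           s' = (a(i := b), y(j := z)))"

fun star_run ::
  "nat \<Rightarrow> nat \<Rightarrow> nat \<Rightarrow> (nat \<Rightarrow> nat) \<Rightarrow> (nat \<Rightarrow> nat) \<Rightarrow> (nat \<times> nat) list \<Rightarrow>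
   alg_state \<Rightarrow> alg_state \<Rightarrow> bool" where
  "star_run n k l p q [] s s' \<longleftrightarrow> s' = s"
| "star_run n k l p q (ij # ijs) s s' \<longleftrightarrow>
     (\<exists>t. star_step n k l p q ij s t \<and> star_run n k l p q ijs t s')"

definition alg_loop :: "nat \<Rightarrow> nat \<Rightarrow> (nat \<times> nat) list" where
  "alg_loop k l = List.product [2..<k+2] [2..<l+2]"

text \<open>The choice of \<open>a\<^sub>k\<^sub>+\<^sub>2, \<dots>, a\<^sub>m\<close> is restricted by the requirement that the output be an
  SDP instance, i.e. that \<open>a\<^sub>1, \<dots>, a\<^sub>m\<close> be linearly independent.\<close>

definition possible_output ::
  "nat \<Rightarrow> nat \<Rightarrow> (nat \<Rightarrow> real mat) \<Rightarrow> (nat \<Rightarrow> real) \<Rightarrow> bool" where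
  "possible_output m n a c \<longleftrightarrow> (\<exists>k l p q s b y.
     alg_params m n k l p q \<and> alg_init n k l p q s \<and>
     star_run n k l p q (alg_loop k l) s (b, y) \<and>
     (\<forall>i\<in>{1..k+1}. a i = b i) \<and>
     (\<forall>i\<in>{k+2..m}. a i \<in> sym_mats n \<and> (\<forall>j\<in>{1..l}. ip (a i) (y j) = 0)) \<and>
     (\<forall>i\<in>{1..k}. c i = 0) \<and> c (k + 1) = -1 \<and>
     (\<forall>i\<in>{k+2..m}. c i = ip (a i) (y (l + 1))) \<and>
     sdp_instance m n a c)"

text \<open>The definition of \<open>nonoverlapping_weakly_infeasible\<close> admits empty blocks \<open>p\<^sub>i = 0\<close> with
  \<open>i \<le> k\<close>, while the algorithm requires \<open>p\<^sub>1, \<dots>, p\<^sub>k > 0\<close>.  With \<open>e\<^sub>r\<^sub>s\<close> the matrix units, the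
  instance \<open>a\<^sub>1 = e\<^sub>1\<^sub>1\<close>, \<open>a\<^sub>2 = e\<^sub>1\<^sub>2 + e\<^sub>2\<^sub>1\<close>, \<open>a\<^sub>3 = e\<^sub>2\<^sub>2 + e\<^sub>1\<^sub>3 + e\<^sub>3\<^sub>1\<close>, \<open>c = (0, 0, -1)\<close> with \<open>n = m = 3\<close>
  is nonoverlapping weakly infeasible (\<open>k = 2\<close>, \<open>p = (1, 0, 1)\<close>, \<open>l = 1\<close>, \<open>q = (1, 0)\<close>,
  \<open>y\<^sub>1 = e\<^sub>3\<^sub>3\<close>, \<open>y\<^sub>2 = - (e\<^sub>1\<^sub>3 + e\<^sub>3\<^sub>1) / 2\<close>), but \<open>c\<close> forces \<open>k = 2\<close> in any run, and then \<open>p\<^sub>2 > 0\<close> fails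
  because the \<open>(2, 2)\<close> entry of \<open>a\<^sub>2\<close> is zero.  The same system is an output once the
  equation \<open>a\<^sub>2 \<bullet> y = 0\<close> is listed last.  In general, such an instance is an output up to the order
  of its equations; the order can be kept whenever \<open>p\<^sub>1, \<dots>, p\<^sub>k > 0\<close>.\<close>

end

theory Submission
  imports Defs
begin

text \<open>Let \<open>P\<^sub>1, \<dots>\<close> and \<open>Q\<^sub>1, \<dots>\<close> be the blocks of the two sequences.  Because the block sizes sum
  to at most \<open>n\<close>, every \<open>P\<^sub>i\<close> is disjoint from every \<open>Q\<^sub>j\<close>.  By the shape of the sequences, \<open>a\<^sub>i\<close>
  then vanishes on \<open>P\<^sub>u \<times> Q\<^sub>v\<close> for \<open>u \<ge> i\<close>, and \<open>y\<^sub>j\<close> vanishes there for \<open>v \<ge> j\<close>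
  (\<open>regfr_zero_on_later_block\<close>, \<open>revregfr_zero_on_later_block\<close>).

  Step \<open>(i, j)\<close> of the loop writes to \<open>P\<^sub>i\<^sub>-\<^sub>1 \<times> Q\<^sub>j\<^sub>-\<^sub>1\<close>.  This block is nonempty and off the diagonal,
  so two symmetric entries of \<open>a\<^sub>i\<close> and \<open>y\<^sub>j\<close> there can give \<open>a\<^sub>i \<bullet> y\<^sub>j\<close> any value
  (\<open>set_block_ip_solvable\<close>).  An equation settled earlier that shares a matrix with this step is
  \<open>a\<^sub>i \<bullet> y\<^sub>j\<^sub>'\<close> with \<open>j' < j\<close> or \<open>a\<^sub>i\<^sub>' \<bullet> y\<^sub>j\<close> with \<open>i' < i\<close>, and its other matrix is zero on the block
  just written; so it stays valid (\<open>star_step_equations_hold\<close>).  The equations with \<open>i = 1\<close> or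
  \<open>j = 1\<close>, which the loop does not visit, hold because the supports of \<open>a\<^sub>i\<close> and \<open>y\<^sub>j\<close> are disjoint
  (\<open>regfr_orthogonal_revregfr\<close>).  Hence every output is nonoverlapping weakly infeasible.

  Conversely, the matrices of a nonoverlapping weakly infeasible instance and its certificate
  satisfy all the equations, so the run that starts with them and changes nothing is admissible.
  It only remains to make the block sizes \<open>p\<^sub>1, \<dots>, p\<^sub>k\<close> and \<open>q\<^sub>1, \<dots>, q\<^sub>l\<close> positive.  Matrices with an
  empty block can be left out of a sequence without moving the other blocks
  (\<open>enumerate_nonempty_blocks\<close>).  For the \<open>y\<^sub>j\<close> this changes nothing in the instance; for the \<open>a\<^sub>i\<close>
  it moves equations to the positions after \<open>k' + 1\<close>, where \<open>k'\<close> is the number of nonempty blocks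
  among the first \<open>k\<close>, and this is why an instance with empty blocks is an output only up to the
  order of its equations.  Some nonempty block survives on each side, since otherwise
  \<open>a\<^sub>k\<^sub>+\<^sub>1 \<bullet> y\<^sub>l\<^sub>+\<^sub>1\<close> would be \<open>0\<close> instead of \<open>-1\<close>.\<close>

section \<open>The inner product entrywise\<close>

lemma sym_mats_entry:
  assumes "a \<in> sym_mats n" "r < n" "s < n"
  shows "a $$ (r, s) = a $$ (s, r)"
proof -
  have "transpose_mat a $$ (r, s) = a $$ (s, r)"
    using assms by (intro index_transpose_mat) (auto simp: sym_mats_def)
  then show ?thesis using assms by (simp add: sym_mats_def)
qed

lemma ip_eq_sum:
  assumes a: "a \<in> sym_mats n" and b: "b \<in> sym_mats n"
  shows "ip a b = (\<Sum>x\<in>{..<n} \<times> {..<n}. a $$ x * b $$ x)"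
proof -
  have "ip a b = (\<Sum>r<n. \<Sum>s<n. a $$ (r, s) * b $$ (s, r))"
    using a b unfolding ip_def mat_trace_def sym_mats_def
    by (auto simp: scalar_prod_def atLeast0LessThan intro!: sum.cong)
  also have "\<dots> = (\<Sum>r<n. \<Sum>s<n. a $$ (r, s) * b $$ (r, s))"
    using sym_mats_entry[OF b] by (intro sum.cong) auto
  finally show ?thesis by (simp add: sum.cartesian_product)
qed

lemma ip_eq_zeroI:
  assumes "a \<in> sym_mats n" "b \<in> sym_mats n"
    and "\<And>r s. r < n \<Longrightarrow> s < n \<Longrightarrow> a $$ (r, s) = 0 \<or> b $$ (r, s) = 0"
  shows "ip a b = 0"
  unfolding ip_eq_sum[OF assms(1,2)] using assms(3) by (intro sum.neutral) auto

lemma ip_commute: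
  assumes "a \<in> sym_mats n" "b \<in> sym_mats n"
  shows "ip a b = ip b a"
  using assms by (simp add: ip_eq_sum mult.commute)

text \<open>Since a block stands for itself and its transpose, it suffices that the second matrix vanishes
  on the half \<open>P \<times> Q\<close>.\<close>

lemma ip_set_block:
  assumes a: "a \<in> sym_mats n" and y: "y \<in> sym_mats n" and b: "set_block n P Q a b"
    and zero: "\<And>r s. r < n \<Longrightarrow> s < n \<Longrightarrow> r \<in> P \<Longrightarrow> s \<in> Q \<Longrightarrow> y $$ (r, s) = 0"
  shows "ip b y = ip a y"
proof -
  have bs: "b \<in> sym_mats n"
    and same: "\<And>r s. r < n \<Longrightarrow> s < n \<Longrightarrow> (r, s) \<notin> P \<times> Q \<union> Q \<times> P \<Longrightarrow> b $$ (r, s) = a $$ (r, s)"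
    using b unfolding set_block_def by auto
  have "b $$ (r, s) * y $$ (r, s) = a $$ (r, s) * y $$ (r, s)" if "r < n" "s < n" for r s
  proof (cases "(r, s) \<in> P \<times> Q \<union> Q \<times> P")
    case True
    then have "y $$ (r, s) = 0"
      using zero that sym_mats_entry[OF y that] by auto
    then show ?thesis by simp
  next
    case False
    then show ?thesis using same that by simp
  qed
  then show ?thesis
    unfolding ip_eq_sum[OF a y] ip_eq_sum[OF bs y] by (intro sum.cong) auto
qed

text \<open>One off-diagonal position in the block suffices to attain any value: with the entry \<open>1\<close> there
  in the first matrix, the inner product is an affine function with slope \<open>2\<close> of the entry there
  in the second one.\<close>

lemma set_block_ip_solvable:
  assumes a: "a \<in> sym_mats n" and y: "y \<in> sym_mats n"
    and r0: "r0 \<in> P" "r0 < n" and s0: "s0 \<in> Q" "s0 < n" and ne: "r0 \<noteq> s0"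
  obtains b z where "set_block n P Q a b" "set_block n P Q y z" "ip b z = v"
proof -
  define D where "D = {(r0, s0), (s0, r0)}"
  define put where "put c t = mat n n (\<lambda>x. if x \<in> D then t else c $$ x)" for c :: "real mat" and t
  have put: "set_block n P Q c (put c t)" if "c \<in> sym_mats n" for c t
    using that r0 s0 sym_mats_entry[OF that]
    by (auto simp: set_block_def put_def D_def sym_mats_def intro!: eq_matI)
  let ?U = "{..<n} \<times> {..<n}"
  define R where "R = (\<Sum>x\<in>?U - D. a $$ x * y $$ x)"
  have DU: "D \<subseteq> ?U" using r0 s0 by (auto simp: D_def)
  have ip: "ip (put a 1) (put y t) = R + 2 * t" for t
  proof -
    have S: "put a 1 \<in> sym_mats n" "put y t \<in> sym_mats n"
      using put[OF a] put[OF y] by (auto simp: set_block_def)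
    have "ip (put a 1) (put y t)
        = (\<Sum>x\<in>?U - D. put a 1 $$ x * put y t $$ x) + (\<Sum>x\<in>D. put a 1 $$ x * put y t $$ x)"
      unfolding ip_eq_sum[OF S] by (rule sum.subset_diff[OF DU]) simp
    also have "(\<Sum>x\<in>?U - D. put a 1 $$ x * put y t $$ x) = R"
      unfolding R_def by (intro sum.cong) (auto simp: put_def)
    also have "(\<Sum>x\<in>D. put a 1 $$ x * put y t $$ x) = (\<Sum>x\<in>D. t)"
      using DU by (intro sum.cong) (auto simp: put_def)
    also have "\<dots> = 2 * t" using ne by (simp add: D_def)
    finally show ?thesis .
  qed
  show ?thesis
    by (rule that[OF put[OF a, of 1] put[OF y, of "(v - R) / 2"]]) (simp add: ip field_simps)
qed

section \<open>Facial reduction sequences with nonoverlapping blocks\<close>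

lemma sum_block_sizes_mono:
  fixes p :: "nat \<Rightarrow> nat"
  assumes "i \<le> j"
  shows "sum p {1..<i} \<le> sum p {1..<j}"
  using assms by (intro sum_mono2) auto

lemma P_block_eq: "i \<ge> 1 \<Longrightarrow> P_block p i = {sum p {1..<i} ..< sum p {1..<i + 1}}"
  by (simp add: P_block_def atLeastLessThanSuc_atLeastAtMost)

lemma Q_block_eq: "j \<ge> 1 \<Longrightarrow> Q_block n q j = {n - sum q {1..<j + 1} ..< n - sum q {1..<j}}"
  by (simp add: Q_block_def atLeastLessThanSuc_atLeastAtMost)

lemma P_block_pred: "i \<ge> 2 \<Longrightarrow> P_block p (i - 1) = {sum p {1..<i - 1} ..< sum p {1..<i}}"
  using P_block_eq[of "i - 1" p] by (simp add: le_diff_conv2)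

lemma Q_block_pred:
  "j \<ge> 2 \<Longrightarrow> Q_block n q (j - 1) = {n - sum q {1..<j} ..< n - sum q {1..<j - 1}}"
  using Q_block_eq[of "j - 1" n q] by (simp add: le_diff_conv2)

lemma P_block_subset:
  assumes "i \<in> {1..k}"
  shows "P_block p i \<subseteq> {..<sum p {1..k}}"
  using assms sum_block_sizes_mono[of "i + 1" "k + 1" p]
  by (auto simp: P_block_eq simp flip: atLeastLessThanSuc_atLeastAtMost)

lemma Q_block_subset:
  assumes "j \<in> {1..l}"
  shows "Q_block n q j \<subseteq> {n - sum q {1..l}..<n}"
  using assms sum_block_sizes_mono[of "j + 1" "l + 1" q]
  by (auto simp: Q_block_eq simp flip: atLeastLessThanSuc_atLeastAtMost)

lemma regfr_sym: "regfr n k p a \<Longrightarrow> i \<in> {1..k} \<Longrightarrow> a i \<in> sym_mats n"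
  by (simp add: regfr_def)

lemma revregfr_sym: "revregfr n l q y \<Longrightarrow> j \<in> {1..l} \<Longrightarrow> y j \<in> sym_mats n"
  by (simp add: revregfr_def)

lemma regfr_entry_zero:
  assumes "regfr n k p a" "i \<in> {1..k}" "r < n" "s < n"
    and "sum p {1..<i} \<le> r" "sum p {1..<i} \<le> s"
    and "r \<noteq> s \<or> sum p {1..k} \<le> r"
  shows "a i $$ (r, s) = 0"
proof -
  have "a i $$ (r, s) = (if r = s \<and> r \<in> P_block p i then 1 else 0)"
    using assms unfolding regfr_def by auto
  then show ?thesis using assms(7) P_block_subset[OF assms(2), of p] by auto
qed

lemma revregfr_entry_zero:
  assumes "revregfr n l q y" "j \<in> {1..l}"
    and "r < n - sum q {1..<j}" "s < n - sum q {1..<j}"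
    and "r \<noteq> s \<or> r < n - sum q {1..l}"
  shows "y j $$ (r, s) = 0"
proof -
  have "y j $$ (r, s) = (if r = s \<and> r \<in> Q_block n q j then 1 else 0)"
    using assms unfolding revregfr_def by auto
  then show ?thesis using assms(5) Q_block_subset[OF assms(2), of n q] by auto
qed

text \<open>A matrix not preceded by any nonempty block consists of an identity block alone, and there the
  matrices of the other sequence vanish.  So the pairs with \<open>i = 1\<close> or \<open>j = 1\<close> need no adjustment,
  and the value \<open>-1\<close> is possible only if a nonempty block precedes on both sides.\<close>

lemma regfr_orthogonal_revregfr:
  assumes a: "regfr n k p a" and y: "revregfr n l q y"
    and nov: "sum p {1..k} + sum q {1..l} \<le> n"
    and i: "i \<in> {1..k}" and j: "j \<in> {1..l}"
    and first: "sum p {1..<i} = 0 \<or> sum q {1..<j} = 0"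
  shows "ip (a i) (y j) = 0"
proof (rule ip_eq_zeroI)
  show "a i \<in> sym_mats n" "y j \<in> sym_mats n"
    using regfr_sym[OF a i] revregfr_sym[OF y j] .
  fix r s assume rs: "r < n" "s < n"
  have pi: "sum p {1..<i} \<le> sum p {1..k}" and qj: "sum q {1..<j} \<le> sum q {1..l}"
    using i j by (auto intro: sum_mono2)
  show "a i $$ (r, s) = 0 \<or> y j $$ (r, s) = 0"
    using first
  proof
    assume "sum p {1..<i} = 0"
    then have "a i $$ (r, s) = 0" if "r \<noteq> s \<or> sum p {1..k} \<le> r"
      using regfr_entry_zero[OF a i rs] that by simp
    moreover have "y j $$ (r, r) = 0" if "r < sum p {1..k}"
      using revregfr_entry_zero[OF y j, of r r] that nov qj by simp
    ultimately show ?thesis by (metis not_le)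
  next
    assume "sum q {1..<j} = 0"
    then have "y j $$ (r, s) = 0" if "r \<noteq> s \<or> r < n - sum q {1..l}"
      using revregfr_entry_zero[OF y j, of r s] rs that by simp
    moreover have "a i $$ (r, r) = 0" if "r \<ge> n - sum q {1..l}"
      using regfr_entry_zero[OF a i, of r r] that nov pi rs by simp
    ultimately show ?thesis by (metis not_le)
  qed
qed

text \<open>The next two lemmas are what keeps the loop from undoing its own work: blocks written in later
  steps lie where the earlier matrices are zero.\<close>

lemma regfr_zero_on_later_block:
  assumes a: "regfr n k p a" and nov: "sum p {1..k} + sum q {1..l} \<le> n"
    and i: "1 \<le> i" "i \<le> i'" "i' \<le> k" and j: "j \<in> {1..l}"
    and r: "r \<in> P_block p i'" and s: "s \<in> Q_block n q j"
  shows "a i $$ (r, s) = 0"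
proof (rule regfr_entry_zero[OF a])
  have "r < sum p {1..k}" using P_block_subset[of i' k p] i r by auto
  moreover have "n - sum q {1..l} \<le> s" "s < n" using Q_block_subset[OF j, of n q] s by auto
  moreover have "sum p {1..<i} \<le> sum p {1..<i'}" using i by (intro sum_block_sizes_mono)
  ultimately show "r < n" "s < n" "sum p {1..<i} \<le> r" "sum p {1..<i} \<le> s"
    "r \<noteq> s \<or> sum p {1..k} \<le> r"
    using r nov i by (auto simp: P_block_def)
qed (use i in auto)

lemma revregfr_zero_on_later_block:
  assumes y: "revregfr n l q y" and nov: "sum p {1..k} + sum q {1..l} \<le> n"
    and j: "1 \<le> j" "j \<le> j'" "j' \<le> l" and i: "i \<in> {1..k}"
    and r: "r \<in> P_block p i" and s: "s \<in> Q_block n q j'"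
  shows "y j $$ (r, s) = 0"
proof (rule revregfr_entry_zero[OF y])
  have "r < sum p {1..k}" using P_block_subset[OF i, of p] r by auto
  moreover have "n - sum q {1..l} \<le> s" "s < n" using Q_block_subset[of j' l n q] j s by auto
  moreover have "sum q {1..<j} \<le> sum q {1..<j'}" using j by (intro sum_block_sizes_mono)
  ultimately show "r < n - sum q {1..<j}" "s < n - sum q {1..<j}"
    "r \<noteq> s \<or> r < n - sum q {1..l}"
    using s nov j by (auto simp: Q_block_def)
qed (use j in auto)

text \<open>The prescribed part of the \<open>i\<close>-th matrix consists of the rows and columns from \<open>P\<^sub>i\<close> on, and
  the overwritten block has its rows in \<open>P\<^sub>i\<^sub>-\<^sub>1\<close>; symmetrically for the reverse sequence.\<close>

lemma regfr_set_block:
  assumes a: "regfr n k p a" and i: "i \<in> {2..k}" and b: "set_block n (P_block p (i - 1)) Q (a i) b"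
  shows "regfr n k p (a(i := b))"
proof -
  have "r \<notin> P_block p (i - 1)" if "sum p {1..<i} \<le> r" for r
    using i that P_block_pred[of i p] by simp
  then have "b $$ (r, s) = a i $$ (r, s)"
    if "r \<in> {sum p {1..<i}..<n}" "s \<in> {sum p {1..<i}..<n}" for r s
    using b that by (auto simp: set_block_def)
  moreover have "b \<in> sym_mats n" using b by (simp add: set_block_def)
  ultimately show ?thesis using a i unfolding regfr_def by auto
qed

lemma revregfr_set_block:
  assumes y: "revregfr n l q y" and j: "j \<in> {2..l}"
    and z: "set_block n P (Q_block n q (j - 1)) (y j) z"
  shows "revregfr n l q (y(j := z))"
proof -
  have "r \<notin> Q_block n q (j - 1)" if "r < n - sum q {1..<j}" for r
    using j that Q_block_pred[of j n q] by simp
  then have "z $$ (r, s) = y j $$ (r, s)"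
    if "r \<in> {..<n - sum q {1..<j}}" "s \<in> {..<n - sum q {1..<j}}" for r s
    using z that by (auto simp: set_block_def)
  moreover have "z \<in> sym_mats n" using z by (simp add: set_block_def)
  ultimately show ?thesis using y j unfolding revregfr_def by auto
qed

section \<open>The loop of the algorithm\<close>

lemma set_alg_loop: "set (alg_loop k l) = {2..k+1} \<times> {2..l+1}"
  by (auto simp: alg_loop_def)

lemma star_stepI:
  assumes "set_block n (P_block p (i - 1)) (Q_block n q (j - 1)) (a i) b"
    and "set_block n (P_block p (i - 1)) (Q_block n q (j - 1)) (y j) z"
    and "ip b z = (if (i, j) = (k + 1, l + 1) then -1 else 0)"
  shows "star_step n k l p q (i, j) (a, y) (a(i := b), y(j := z))"
  unfolding star_step_def prod.case using assms by blast

lemma star_step_alg_init: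
  assumes s: "alg_init n k l p q s" and ij: "ij \<in> {2..k+1} \<times> {2..l+1}"
    and step: "star_step n k l p q ij s s'"
  shows "alg_init n k l p q s'"
proof -
  obtain i j a y where eq: "ij = (i, j)" "s = (a, y)" by (metis surj_pair)
  with step obtain b z where
    "set_block n (P_block p (i - 1)) (Q_block n q (j - 1)) (a i) b"
    "set_block n (P_block p (i - 1)) (Q_block n q (j - 1)) (y j) z"
    "s' = (a(i := b), y(j := z))"
    unfolding star_step_def by auto
  then show ?thesis
    using s ij eq regfr_set_block[of n "k + 1" p a i] revregfr_set_block[of n "l + 1" q y j]
    by (simp add: alg_init_def)
qed

lemma star_run_alg_init:
  assumes "star_run n k l p q ijs s s'" "alg_init n k l p q s"
    and "set ijs \<subseteq> {2..k+1} \<times> {2..l+1}"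
  shows "alg_init n k l p q s'"
  using assms
proof (induction ijs arbitrary: s)
  case (Cons ij ijs)
  then obtain t where "star_step n k l p q ij s t" "star_run n k l p q ijs t s'" by auto
  then show ?case
    using Cons.IH[of t] Cons.prems star_step_alg_init[of n k l p q s ij t] by simp
qed simp

lemma star_step_solvable:
  assumes par: "alg_params m n k l p q" and t: "alg_init n k l p q t"
    and ij: "ij \<in> {2..k+1} \<times> {2..l+1}"
  shows "\<exists>t'. star_step n k l p q ij t t'"
proof -
  obtain i j a y where eq: "ij = (i, j)" "t = (a, y)" by (metis surj_pair)
  have i: "i \<in> {2..k+1}" and j: "j \<in> {2..l+1}" using ij eq by auto
  have nov: "sum p {1..k+1} + sum q {1..l+1} \<le> n"
    using par by (simp add: alg_params_def)
  have i1: "i - 1 \<in> {1..k+1}" and j1: "j - 1 \<in> {1..l+1}" using i j by auto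
  have "i - 1 \<in> {1..k}" "j - 1 \<in> {1..l}" using i j by auto
  then have pos: "p (i - 1) > 0" "q (j - 1) > 0" using par by (auto simp: alg_params_def)
  \<comment> \<open>the first elements of the two blocks\<close>
  define r0 where "r0 = sum p {1..<i - 1}"
  define s0 where "s0 = n - sum q {1..<j}"
  have r0: "r0 \<in> P_block p (i - 1)"
    using pos i1 by (simp add: P_block_def r0_def sum.last_plus)
  have "sum q {1..<j} = sum q {1..<j - 1} + q (j - 1)"
    using j by (cases j) auto
  moreover have "sum q {1..<j} \<le> sum q {1..l+1}" using j by (intro sum_mono2) auto
  ultimately have "n - sum q {1..<j} < n - sum q {1..<j - 1}"
    using pos nov by linarith
  then have s0: "s0 \<in> Q_block n q (j - 1)"
    using j Q_block_pred[of j n q] unfolding s0_def by simp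
  have r0': "r0 < sum p {1..k+1}" using P_block_subset[OF i1, of p] r0 by auto
  have s0': "n - sum q {1..l+1} \<le> s0" "s0 < n" using Q_block_subset[OF j1, of n q] s0 by auto
  have sym: "a i \<in> sym_mats n" "y j \<in> sym_mats n"
    using t eq i j by (auto simp: alg_init_def regfr_def revregfr_def)
  have "r0 < n" "r0 \<noteq> s0" using r0' s0' nov by auto
  then obtain b z where
    "set_block n (P_block p (i - 1)) (Q_block n q (j - 1)) (a i) b"
    "set_block n (P_block p (i - 1)) (Q_block n q (j - 1)) (y j) z"
    "ip b z = (if (i, j) = (k + 1, l + 1) then -1 else 0)"
    using set_block_ip_solvable[OF sym r0 _ s0 s0'(2)] by metis
  then have "star_step n k l p q ij t (a(i := b), y(j := z))"
    unfolding eq by (rule star_stepI)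
  then show ?thesis ..
qed

definition equations_hold ::
  "nat \<Rightarrow> nat \<Rightarrow> (nat \<times> nat) set \<Rightarrow> alg_state \<Rightarrow> bool" where
  "equations_hold k l D s \<longleftrightarrow> (\<forall>(i, j)\<in>D.
     ip (fst s i) (snd s j) = (if (i, j) = (k + 1, l + 1) then -1 else 0))"

text \<open>Only the earlier pairs in the same row or in the same column share a matrix with the current
  one, so the traversal order matters only through them.\<close>

definition may_precede :: "nat \<times> nat \<Rightarrow> nat \<times> nat \<Rightarrow> bool" where
  "may_precede d e \<longleftrightarrow> (fst d = fst e \<longrightarrow> snd d < snd e) \<and> (snd d = snd e \<longrightarrow> fst d < fst e)"

lemma sorted_wrt_product_may_precede:
  "sorted_wrt (<) xs \<Longrightarrow> sorted_wrt (<) ys \<Longrightarrow> sorted_wrt may_precede (List.product xs ys)"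
proof (induction xs)
  case (Cons x xs)
  have "sorted_wrt may_precede (map (Pair x) ys)"
    using Cons.prems(2) unfolding sorted_wrt_map
    by (rule sorted_wrt_mono_rel[rotated]) (simp add: may_precede_def)
  then show ?case
    using Cons by (auto simp: sorted_wrt_append) (auto simp: may_precede_def)
qed simp

text \<open>The block that a step overwrites lies beyond the blocks of the earlier matrices, which are
  therefore zero on it; hence the equations already settled remain valid.\<close>

lemma star_step_equations_hold:
  assumes nov: "sum p {1..k+1} + sum q {1..l+1} \<le> n"
    and s: "alg_init n k l p q s" and eqs: "equations_hold k l D s"
    and D: "D \<subseteq> {2..k+1} \<times> {2..l+1}" and ij: "ij \<in> {2..k+1} \<times> {2..l+1}"
    and prec: "\<And>d. d \<in> D \<Longrightarrow> may_precede d ij"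
    and step: "star_step n k l p q ij s s'"
  shows "equations_hold k l (insert ij D) s'"
proof -
  obtain i j a y where eq: "ij = (i, j)" "s = (a, y)" by (metis surj_pair)
  let ?P = "P_block p (i - 1)" and ?Q = "Q_block n q (j - 1)"
  from step eq obtain b z where
    b: "set_block n ?P ?Q (a i) b" and z: "set_block n ?P ?Q (y j) z"
    and ip: "ip b z = (if (i, j) = (k + 1, l + 1) then -1 else 0)"
    and s': "s' = (a(i := b), y(j := z))"
    unfolding star_step_def by auto
  have i: "i \<in> {2..k+1}" and j: "j \<in> {2..l+1}" using ij eq by auto
  then have i1: "i - 1 \<in> {1..k+1}" and j1: "j - 1 \<in> {1..l+1}" by auto
  have a: "regfr n (k + 1) p a" and y: "revregfr n (l + 1) q y"
    using s eq by (auto simp: alg_init_def)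
  have kept: "ip (fst s' i') (snd s' j') = ip (a i') (y j')" if d: "(i', j') \<in> D" for i' j'
  proof -
    have i': "i' \<in> {2..k+1}" and j': "j' \<in> {2..l+1}" using d D by auto
    have pr: "i' = i \<Longrightarrow> j' < j" "j' = j \<Longrightarrow> i' < i"
      using prec[OF d] eq by (auto simp: may_precede_def)
    have sa: "a i' \<in> sym_mats n" and sy: "y j' \<in> sym_mats n"
      using regfr_sym[OF a, of i'] revregfr_sym[OF y, of j'] i' j' by auto
    consider "i' = i" "j' < j" | "j' = j" "i' < i" | "i' \<noteq> i" "j' \<noteq> j"
      using pr by auto
    then show ?thesis
    proof cases
      case 1
      have "y j' $$ (r, t) = 0" if "r \<in> ?P" "t \<in> ?Q" for r t
        using revregfr_zero_on_later_block[OF y nov _ _ _ i1 that, of j'] 1 j1 j' by auto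
      then show ?thesis
        using ip_set_block[of "a i" n "y j'"] sa sy b 1 s' by simp
    next
      case 2
      have zero: "a i' $$ (r, t) = 0" if "r \<in> ?P" "t \<in> ?Q" for r t
        using regfr_zero_on_later_block[OF a nov _ _ _ j1 that, of i'] 2 i1 i' by auto
      have "ip z (a i') = ip (y j) (a i')"
        using ip_set_block[of "y j" n "a i'"] sa sy z 2 zero by simp
      then have "ip (a i') z = ip (a i') (y j)"
        using sa sy z 2 ip_commute by (metis set_block_def)
      then show ?thesis using 2 s' by simp
    next
      case 3
      then show ?thesis using s' by simp
    qed
  qed
  have "ip (fst s' i) (snd s' j) = (if (i, j) = (k + 1, l + 1) then -1 else 0)"
    using ip s' by simp
  then show ?thesis
    using eqs kept eq unfolding equations_hold_def by fastforce
qed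

lemma star_run_equations_hold:
  assumes "sum p {1..k+1} + sum q {1..l+1} \<le> n"
    and "star_run n k l p q ijs s s'" "alg_init n k l p q s" "equations_hold k l D s"
    and "D \<subseteq> {2..k+1} \<times> {2..l+1}" "set ijs \<subseteq> {2..k+1} \<times> {2..l+1}"
    and "sorted_wrt may_precede ijs" "\<And>d e. d \<in> D \<Longrightarrow> e \<in> set ijs \<Longrightarrow> may_precede d e"
  shows "equations_hold k l (D \<union> set ijs) s'"
  using assms(2-)
proof (induction ijs arbitrary: s D)
  case Nil
  then show ?case by simp
next
  case (Cons ij ijs)
  from Cons.prems(1) obtain t where
    t: "star_step n k l p q ij s t" "star_run n k l p q ijs t s'" by auto
  have "alg_init n k l p q t"
    using star_step_alg_init[OF Cons.prems(2) _ t(1)] Cons.prems(5) by simp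
  moreover have "equations_hold k l (insert ij D) t"
    using star_step_equations_hold[OF assms(1) Cons.prems(2-4) _ _ t(1)] Cons.prems(5,7) by simp
  ultimately have "equations_hold k l (insert ij D \<union> set ijs) s'"
    using Cons.prems by (intro Cons.IH[OF t(2)]) auto
  then show ?case by simp
qed

lemma alg_loop_orthogonal:
  assumes par: "alg_params m n k l p q" and s: "alg_init n k l p q s"
    and run: "star_run n k l p q (alg_loop k l) s (a, y)"
    and i: "i \<in> {1..k+1}" and j: "j \<in> {1..l+1}"
  shows "ip (a i) (y j) = (if (i, j) = (k + 1, l + 1) then -1 else 0)"
proof (cases "i = 1 \<or> j = 1")
  case True
  have "alg_init n k l p q (a, y)"
    using star_run_alg_init[OF run s] by (simp add: set_alg_loop)
  then have "ip (a i) (y j) = 0"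
    using True i j par
    by (intro regfr_orthogonal_revregfr[of n "k + 1" p a "l + 1" q y])
       (auto simp: alg_init_def alg_params_def)
  then show ?thesis using True par by (auto simp: alg_params_def)
next
  case False
  have "sorted_wrt may_precede (alg_loop k l)"
    unfolding alg_loop_def by (intro sorted_wrt_product_may_precede sorted_wrt_upt)
  then have "equations_hold k l ({} \<union> set (alg_loop k l)) (a, y)"
    using par by (intro star_run_equations_hold[OF _ run s])
      (auto simp: set_alg_loop alg_params_def equations_hold_def)
  then show ?thesis using False i j by (auto simp: set_alg_loop equations_hold_def)
qed

section \<open>Outputs are nonoverlapping weakly infeasible\<close>

lemma le_sum_of_pos:
  fixes p :: "nat \<Rightarrow> nat"
  assumes "\<forall>i\<in>{1..k}. p i > 0"
  shows "k \<le> sum p {1..k + 1}"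
proof -
  have "(\<Sum>i=1..k. 1) \<le> sum p {1..k}" using assms by (intro sum_mono) (auto simp: Suc_le_eq)
  then show ?thesis by simp
qed

lemma regfr_cong:
  assumes "\<And>i. i \<in> {1..k} \<Longrightarrow> a i = b i"
  shows "regfr n k p a \<longleftrightarrow> regfr n k p b"
  using assms unfolding regfr_def by auto

theorem possible_output_nonoverlapping_weakly_infeasible:
  assumes "possible_output m n a c"
  shows "nonoverlapping_weakly_infeasible m n a c"
proof -
  from assms obtain k l p q s b y where
    par: "alg_params m n k l p q" and s: "alg_init n k l p q s"
    and run: "star_run n k l p q (alg_loop k l) s (b, y)"
    and ab: "\<forall>i\<in>{1..k+1}. a i = b i"
    and rest: "\<forall>i\<in>{k+2..m}. a i \<in> sym_mats n \<and> (\<forall>j\<in>{1..l}. ip (a i) (y j) = 0)"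
    and c: "\<forall>i\<in>{1..k}. c i = 0" "c (k + 1) = -1" "\<forall>i\<in>{k+2..m}. c i = ip (a i) (y (l + 1))"
    and inst: "sdp_instance m n a c"
    unfolding possible_output_def by auto
  have "alg_init n k l p q (b, y)"
    using star_run_alg_init[OF run s] by (simp add: set_alg_loop)
  then have reg: "regfr n (k + 1) p a" "revregfr n (l + 1) q y"
    using ab regfr_cong[of "k + 1" a b n p] by (auto simp: alg_init_def)
  have ip: "ip (a i) (y j) = (if (i, j) = (k + 1, l + 1) then -1 else 0)"
    if "i \<in> {1..k+1}" "j \<in> {1..l+1}" for i j
    using alg_loop_orthogonal[OF par s run that] ab that by simp
  have split: "i \<in> {1..k} \<or> i = k + 1 \<or> i \<in> {k+2..m}" if "i \<in> {1..m}" for i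
    using that by auto
  have "ip (a i) (y j) = 0" if "i \<in> {1..m}" "j \<in> {1..l}" for i j
    using split[OF that(1)] ip[of i j] rest that(2) by auto
  moreover have "ip (a i) (y (l + 1)) = c i" if "i \<in> {1..m}" for i
    using split[OF that] ip[of i "l + 1"] c by auto
  moreover have "k \<le> n" "l \<le> n"
    using par le_sum_of_pos[of k p] le_sum_of_pos[of l q] by (auto simp: alg_params_def)
  ultimately have "nonoverlapping_witness m n a c k l p q y"
    using par c reg unfolding nonoverlapping_witness_def alg_params_def by simp
  then show ?thesis using inst unfolding nonoverlapping_weakly_infeasible_def by blast
qed

section \<open>Dropping empty blocks\<close>

text \<open>The map \<open>f\<close> enumerates the indices of the nonempty blocks, followed by \<open>k + 1\<close>.  Preservation
  of the partial sums says that every remaining block keeps its place.\<close>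

lemma enumerate_nonempty_blocks:
  fixes p :: "nat \<Rightarrow> nat"
  shows "\<exists>k' f. k' \<le> k \<and> f ` {1..k'} \<subseteq> {1..k} \<and> f (k' + 1) = k + 1 \<and> inj_on f {1..k'+1} \<and>
    (\<forall>i\<in>{1..k'}. p (f i) > 0) \<and>
    (\<forall>i\<in>{1..k'+1}. (\<Sum>u=1..<i. p (f u)) = (\<Sum>u=1..<f i. p u))"
proof (induction k)
  case 0
  show ?case by (rule exI[of _ 0], rule exI[of _ id]) simp
next
  case (Suc k)
  then obtain k' f where k': "k' \<le> k" and ran: "f ` {1..k'} \<subseteq> {1..k}" and last: "f (k' + 1) = k + 1"
    and inj: "inj_on f {1..k'+1}" and pos: "\<forall>i\<in>{1..k'}. p (f i) > 0"
    and sums: "\<forall>i\<in>{1..k'+1}. (\<Sum>u=1..<i. p (f u)) = (\<Sum>u=1..<f i. p u)"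
    by blast
  show ?case
  proof (cases "p (k + 1) = 0")
    case True
    define g where "g = f(k' + 1 := k + 2)"
    have g: "g (k' + 1) = k + 2" "\<And>i. i \<noteq> k' + 1 \<Longrightarrow> g i = f i" by (simp_all add: g_def)
    have ran': "g ` {1..k'} \<subseteq> {1..k}" using ran g(2) by auto
    have inj': "inj_on g {1..k'+1}"
    proof -
      have "inj_on g {1..k'}" using inj g(2) by (auto simp: inj_on_def)
      moreover have "g (k' + 1) \<notin> g ` {1..k'}" using ran' g(1) by auto
      ultimately show ?thesis by (simp add: atLeastAtMostSuc_conv)
    qed
    have upd: "(\<Sum>u=1..<i. p (g u)) = (\<Sum>u=1..<i. p (f u))" if "i \<le> k' + 1" for i
      using that g(2) by (intro sum.cong) auto
    have sums': "(\<Sum>u=1..<i. p (g u)) = (\<Sum>u=1..<g i. p u)" if i: "i \<in> {1..k'+1}" for i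
    proof (cases "i = k' + 1")
      case True
      then show ?thesis
        using sums[rule_format, OF i] upd[of i] last \<open>p (k + 1) = 0\<close> g(1) by simp
    next
      case False
      then show ?thesis using sums[rule_format, OF i] upd[of i] i g(2) by simp
    qed
    have "g ` {1..k'} \<subseteq> {1..Suc k}" using ran' by auto
    moreover have "p (g i) > 0" if "i \<in> {1..k'}" for i using that pos g(2) by simp
    moreover have "k' \<le> Suc k" "g (k' + 1) = Suc k + 1" using k' g(1) by simp_all
    ultimately show ?thesis using inj' sums' by blast
  next
    case False
    define g where "g = f(k' + 2 := k + 2)"
    have g: "g (k' + 2) = k + 2" "\<And>i. i \<noteq> k' + 2 \<Longrightarrow> g i = f i" by (simp_all add: g_def)
    have ran': "g ` {1..k'+1} \<subseteq> {1..Suc k}"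
      using ran last g(2) by (auto simp: image_subset_iff le_Suc_eq)
    have inj': "inj_on g {1..k'+1+1}"
    proof -
      have "inj_on g {1..k'+1}" using inj g(2) by (auto simp: inj_on_def)
      moreover have "g (k' + 2) \<notin> g ` {1..k'+1}" using ran' g(1) by auto
      moreover have "{1..k'+1+1} = insert (k' + 2) {1..k'+1}" by auto
      ultimately show ?thesis by simp
    qed
    have upd: "(\<Sum>u=1..<i. p (g u)) = (\<Sum>u=1..<i. p (f u))" if "i \<le> k' + 2" for i
      using that g(2) by (intro sum.cong) auto
    have sums': "(\<Sum>u=1..<i. p (g u)) = (\<Sum>u=1..<g i. p u)" if i: "i \<in> {1..k'+1+1}" for i
    proof (cases "i = k' + 2")
      case True
      have "(\<Sum>u=1..<k'+2. p (f u)) = (\<Sum>u=1..<k'+1. p (f u)) + p (f (k' + 1))"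
        by simp
      also have "\<dots> = (\<Sum>u=1..<k+2. p u)"
        using sums[rule_format, of "k' + 1"] last by simp
      finally show ?thesis using True upd[of i] g(1) by simp
    next
      case False
      then show ?thesis using sums[rule_format, of i] upd[of i] i g(2) by simp
    qed
    have "p (g i) > 0" if "i \<in> {1..k'+1}" for i
      using that pos last False g(2) by (cases "i = k' + 1") auto
    moreover have "k' + 1 \<le> Suc k" "g (k' + 1 + 1) = Suc k + 1" using k' g(1) by simp_all
    ultimately show ?thesis using ran' inj' sums' by blast
  qed
qed

lemma P_block_reindex:
  assumes "(\<Sum>u=1..<i. p (f u)) = (\<Sum>u=1..<f i. p u)" "i \<ge> 1" "f i \<ge> 1"
  shows "P_block (p \<circ> f) i = P_block p (f i)"
  using assms by (simp add: P_block_eq)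

lemma Q_block_reindex:
  assumes "(\<Sum>u=1..<i. q (f u)) = (\<Sum>u=1..<f i. q u)" "i \<ge> 1" "f i \<ge> 1"
  shows "Q_block n (q \<circ> f) i = Q_block n q (f i)"
  using assms by (simp add: Q_block_eq)

lemma sum_reindex_blocks:
  fixes p f :: "nat \<Rightarrow> nat"
  assumes "f (k' + 1) = k + 1" "\<forall>i\<in>{1..k'+1}. (\<Sum>u=1..<i. p (f u)) = (\<Sum>u=1..<f i. p u)"
  shows "sum (p \<circ> f) {1..k'+1} = sum p {1..k+1}"
proof -
  have "(\<Sum>u=1..<k'+1. p (f u)) = sum p {1..<k+1}"
    using assms(2)[rule_format, of "k' + 1"] assms(1) by simp
  then show ?thesis using assms(1) by (simp add: atLeastLessThanSuc_atLeastAtMost)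
qed

lemma regfr_reindex:
  assumes a: "regfr n (k + 1) p a"
    and ran: "f ` {1..k'} \<subseteq> {1..k}" and last: "f (k' + 1) = k + 1"
    and sums: "\<forall>i\<in>{1..k'+1}. (\<Sum>u=1..<i. p (f u)) = (\<Sum>u=1..<f i. p u)"
  shows "regfr n (k' + 1) (p \<circ> f) (a \<circ> f)"
proof -
  have f: "f i \<in> {1..k+1}" if "i \<in> {1..k'+1}" for i
    using ran last that by (cases "i = k' + 1") force+
  show ?thesis
    unfolding regfr_def
  proof (intro conjI ballI)
    show "sum (p \<circ> f) {1..k'+1} \<le> n"
      using a sum_reindex_blocks[OF last sums] by (simp add: regfr_def)
    fix i assume i: "i \<in> {1..k'+1}"
    show "(a \<circ> f) i \<in> sym_mats n" using regfr_sym[OF a f[OF i]] by simp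
    fix r s assume "r \<in> {sum (p \<circ> f) {1..<i}..<n}" "s \<in> {sum (p \<circ> f) {1..<i}..<n}"
    moreover have "P_block (p \<circ> f) i = P_block p (f i)"
      using sums i f[OF i] by (intro P_block_reindex) auto
    ultimately show "(a \<circ> f) i $$ (r, s) = (if r = s \<and> r \<in> P_block (p \<circ> f) i then 1 else 0)"
      using a f[OF i] sums i unfolding regfr_def by simp
  qed
qed

lemma revregfr_reindex:
  assumes y: "revregfr n (l + 1) q y"
    and ran: "f ` {1..l'} \<subseteq> {1..l}" and last: "f (l' + 1) = l + 1"
    and sums: "\<forall>j\<in>{1..l'+1}. (\<Sum>v=1..<j. q (f v)) = (\<Sum>v=1..<f j. q v)"
  shows "revregfr n (l' + 1) (q \<circ> f) (y \<circ> f)"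
proof -
  have f: "f j \<in> {1..l+1}" if "j \<in> {1..l'+1}" for j
    using ran last that by (cases "j = l' + 1") force+
  show ?thesis
    unfolding revregfr_def
  proof (intro conjI ballI)
    show "sum (q \<circ> f) {1..l'+1} \<le> n"
      using y sum_reindex_blocks[OF last sums] by (simp add: revregfr_def)
    fix j assume j: "j \<in> {1..l'+1}"
    show "(y \<circ> f) j \<in> sym_mats n" using revregfr_sym[OF y f[OF j]] by simp
    fix r s assume "r \<in> {..<n - sum (q \<circ> f) {1..<j}}" "s \<in> {..<n - sum (q \<circ> f) {1..<j}}"
    moreover have "Q_block n (q \<circ> f) j = Q_block n q (f j)"
      using sums j f[OF j] by (intro Q_block_reindex) auto
    ultimately show "(y \<circ> f) j $$ (r, s) = (if r = s \<and> r \<in> Q_block n (q \<circ> f) j then 1 else 0)"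
      using y f[OF j] sums j unfolding revregfr_def by simp
  qed
qed

section \<open>Nonoverlapping weakly infeasible instances are outputs\<close>

text \<open>A run may start from the final matrices and leave them unchanged in every step.\<close>

lemma star_run_refl:
  assumes "alg_init n k l p q (a, y)" "set ijs \<subseteq> {2..k+1} \<times> {2..l+1}"
    and "equations_hold k l (set ijs) (a, y)"
  shows "star_run n k l p q ijs (a, y) (a, y)"
  using assms(2,3)
proof (induction ijs)
  case (Cons ij ijs)
  obtain i j where ij: "ij = (i, j)" by (metis surj_pair)
  have "a i \<in> sym_mats n" "y j \<in> sym_mats n"
    using assms(1) Cons.prems(1) ij by (auto simp: alg_init_def regfr_def revregfr_def)
  then have "set_block n (P_block p (i - 1)) (Q_block n q (j - 1)) (a i) (a i)"
    and "set_block n (P_block p (i - 1)) (Q_block n q (j - 1)) (y j) (y j)"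
    by (auto simp: set_block_def)
  moreover have "ip (a i) (y j) = (if (i, j) = (k + 1, l + 1) then -1 else 0)"
    using Cons.prems(2) ij by (simp add: equations_hold_def)
  ultimately have "star_step n k l p q ij (a, y) (a, y)"
    using star_stepI[of n p i q j a "a i" y "y j" k l] ij by simp
  moreover have "star_run n k l p q ijs (a, y) (a, y)"
    using Cons by (simp add: equations_hold_def)
  ultimately show ?case by auto
qed simp

text \<open>Empty blocks \<open>Q\<^sub>j\<close> can be dropped from the certificate \<open>y\<close> without touching the instance, so its
  equations keep their order.\<close>

theorem possible_output_if_witness:
  assumes inst: "sdp_instance m n a c" and wit: "nonoverlapping_witness m n a c k l p q y"
    and pos: "\<forall>i\<in>{1..k}. p i > 0"
  shows "possible_output m n a c"
proof -
  obtain l' g where l': "l' \<le> l" and ran: "g ` {1..l'} \<subseteq> {1..l}" and last: "g (l' + 1) = l + 1"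
    and qpos: "\<forall>j\<in>{1..l'}. q (g j) > 0"
    and sums: "\<forall>j\<in>{1..l'+1}. (\<Sum>v=1..<j. q (g v)) = (\<Sum>v=1..<g j. q v)"
    using enumerate_nonempty_blocks[of l q] by blast
  note w = wit[unfolded nonoverlapping_witness_def]
  have a: "regfr n (k + 1) p a" and y: "revregfr n (l' + 1) (q \<circ> g) (y \<circ> g)"
    using w revregfr_reindex[OF _ ran last sums] by auto
  have nov: "sum p {1..k+1} + sum (q \<circ> g) {1..l'+1} \<le> n"
    using w sum_reindex_blocks[OF last sums] by simp
  have ip0: "ip (a i) ((y \<circ> g) j) = 0" if "i \<in> {1..m}" "j \<in> {1..l'}" for i j
    using w that subsetD[OF ran imageI[OF that(2)]] by simp
  have ip1: "ip (a i) ((y \<circ> g) (l' + 1)) = c i" if "i \<in> {1..m}" for i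
    using w last that by auto
  have "l' > 0"
  proof (rule ccontr)
    assume "\<not> l' > 0"
    then have "ip (a (k + 1)) ((y \<circ> g) (l' + 1)) = 0"
      by (intro regfr_orthogonal_revregfr[OF a y nov]) auto
    then show False using ip1[of "k + 1"] w by simp
  qed
  then have par: "alg_params m n k l' p (q \<circ> g)"
    using w pos qpos nov by (simp add: alg_params_def)
  have init: "alg_init n k l' p (q \<circ> g) (a, y \<circ> g)"
    using a y by (simp add: alg_init_def)
  have "equations_hold k l' ({2..k+1} \<times> {2..l'+1}) (a, y \<circ> g)"
    unfolding equations_hold_def
  proof safe
    fix i j assume i: "i \<in> {2..k+1}" and j: "j \<in> {2..l'+1}"
    have "i \<in> {1..m}" using i w by auto
    then show "ip (fst (a, y \<circ> g) i) (snd (a, y \<circ> g) j)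
        = (if (i, j) = (k + 1, l' + 1) then -1 else 0)"
      using ip0[of i j] ip1[of i] i j w by (cases "j = l' + 1"; cases "i = k + 1") auto
  qed
  then have run: "star_run n k l' p (q \<circ> g) (alg_loop k l') (a, y \<circ> g) (a, y \<circ> g)"
    by (intro star_run_refl[OF init]) (simp_all add: set_alg_loop)
  have "a i \<in> sym_mats n" if "i \<in> {1..m}" for i
    using inst that by (simp add: sdp_instance_def)
  then have "\<forall>i\<in>{k+2..m}. a i \<in> sym_mats n \<and> (\<forall>j\<in>{1..l'}. ip (a i) ((y \<circ> g) j) = 0)"
    and "\<forall>i\<in>{k+2..m}. c i = ip (a i) ((y \<circ> g) (l' + 1))"
    using ip0 ip1 by auto
  then show ?thesis
    unfolding possible_output_def using par init run inst w
    by (intro exI[of _ k] exI[of _ l'] exI[of _ p] exI[of _ "q \<circ> g"] exI[of _ "(a, y \<circ> g)"]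
        exI[of _ a] exI[of _ "y \<circ> g"]) blast
qed

lemma inj_on_extends_to_permutation:
  assumes fin: "finite S" and A: "A \<subseteq> S" and f: "f ` A \<subseteq> S" "inj_on f A"
  shows "\<exists>\<pi>. \<pi> permutes S \<and> (\<forall>x\<in>A. \<pi> x = f x)"
proof -
  have "card (S - A) = card (S - f ` A)"
    using fin A f by (simp add: card_Diff_subset finite_subset card_image)
  then obtain h where h: "bij_betw h (S - A) (S - f ` A)"
    using fin finite_same_card_bij by (metis finite_Diff)
  define \<pi> where "\<pi> x = (if x \<in> A then f x else if x \<in> S then h x else x)" for x
  have "bij_betw \<pi> A (f ` A)"
    using f by (auto simp: bij_betw_def \<pi>_def inj_on_def)
  moreover have "bij_betw \<pi> (S - A) (S - f ` A)"
    using h by (rule bij_betw_cong[THEN iffD1, rotated]) (simp add: \<pi>_def)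
  ultimately have "bij_betw \<pi> (A \<union> (S - A)) (f ` A \<union> (S - f ` A))"
    by (rule bij_betw_combine) auto
  moreover have "A \<union> (S - A) = S" "f ` A \<union> (S - f ` A) = S" using A f by auto
  ultimately have "bij_betw \<pi> S S" by simp
  then have "\<pi> permutes S"
    by (rule bij_imp_permutes) (use A in \<open>auto simp: \<pi>_def\<close>)
  then show ?thesis by (auto simp: \<pi>_def)
qed

text \<open>Permuting the equations permutes the coordinates of \<open>x\<close> in \<open>\<Sum>\<^sub>i x\<^sub>i a\<^sub>i\<close>.\<close>

lemma sdp_instance_permute:
  assumes inst: "sdp_instance m n a c" and \<pi>: "\<pi> permutes {1..m}"
  shows "sdp_instance m n (a \<circ> \<pi>) c'"
proof -
  have reindex: "sdp_op m n (a \<circ> \<pi>) x = sdp_op m n a (x \<circ> inv_into UNIV \<pi>)" for x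
  proof -
    have "(\<Sum>i=1..m. x i * a (\<pi> i) $$ rs) = (\<Sum>i=1..m. x (inv_into UNIV \<pi> i) * a i $$ rs)" for rs
      using sum.permute[OF \<pi>, of "\<lambda>i. x (inv_into UNIV \<pi> i) * a i $$ rs"] permutes_inverses(2)[OF \<pi>]
      by (simp add: o_def)
    then show ?thesis by (simp add: sdp_op_def)
  qed
  have "x = x'"
    if x: "x \<in> {1..m} \<rightarrow>\<^sub>E UNIV" and x': "x' \<in> {1..m} \<rightarrow>\<^sub>E UNIV"
      and eq: "sdp_op m n (a \<circ> \<pi>) x = sdp_op m n (a \<circ> \<pi>) x'" for x x' :: "nat \<Rightarrow> real"
  proof -
    have ext: "z \<circ> inv_into UNIV \<pi> \<in> {1..m} \<rightarrow>\<^sub>E UNIV" if "z \<in> {1..m} \<rightarrow>\<^sub>E UNIV" for z :: "nat \<Rightarrow> real"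
      using that permutes_not_in[OF permutes_inv[OF \<pi>]] by (auto simp: PiE_iff extensional_def)
    have "x \<circ> inv_into UNIV \<pi> = x' \<circ> inv_into UNIV \<pi>"
      using inst eq ext[OF x] ext[OF x'] unfolding reindex sdp_instance_def
      by (blast dest: inj_onD)
    then have "x (inv_into UNIV \<pi> (\<pi> i)) = x' (inv_into UNIV \<pi> (\<pi> i))" for i
      by (metis comp_apply)
    then show ?thesis using permutes_inverses(2)[OF \<pi>] by auto
  qed
  moreover have "(a \<circ> \<pi>) i \<in> sym_mats n" if "i \<in> {1..m}" for i
    using inst permutes_in_image[OF \<pi>, of i] that by (simp add: sdp_instance_def)
  ultimately show ?thesis by (simp add: sdp_instance_def inj_on_def)
qed

text \<open>The equations with nonempty blocks come first, followed by the one with right-hand side \<open>-1\<close>;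
  all the others go after it in any order.\<close>

theorem possible_output_up_to_order:
  assumes "nonoverlapping_weakly_infeasible m n a c"
  shows "\<exists>\<pi>. \<pi> permutes {1..m} \<and> possible_output m n (a \<circ> \<pi>) (c \<circ> \<pi>)"
proof -
  from assms obtain k l p q y where inst: "sdp_instance m n a c"
    and wit: "nonoverlapping_witness m n a c k l p q y"
    unfolding nonoverlapping_weakly_infeasible_def by blast
  note w = wit[unfolded nonoverlapping_witness_def]
  obtain k' f where k': "k' \<le> k" and ran: "f ` {1..k'} \<subseteq> {1..k}" and last: "f (k' + 1) = k + 1"
    and inj: "inj_on f {1..k'+1}" and pos: "\<forall>i\<in>{1..k'}. p (f i) > 0"
    and sums: "\<forall>i\<in>{1..k'+1}. (\<Sum>u=1..<i. p (f u)) = (\<Sum>u=1..<f i. p u)"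
    using enumerate_nonempty_blocks[of k p] by blast
  have "f ` {1..k'} \<subseteq> {1..m}" "k + 1 \<in> {1..m}" using ran w by auto
  moreover have "{1..k'+1} = insert (k' + 1) {1..k'}" by auto
  ultimately have f: "f ` {1..k'+1} \<subseteq> {1..m}"
    using last by (metis image_insert insert_subset)
  obtain \<pi> where \<pi>: "\<pi> permutes {1..m}" and \<pi>f: "\<forall>i\<in>{1..k'+1}. \<pi> i = f i"
    using inj_on_extends_to_permutation[OF _ _ f inj] k' w by auto
  have in_m: "\<pi> i \<in> {1..m}" if "i \<in> {1..m}" for i
    using permutes_in_image[OF \<pi>] that by blast
  have reg_f: "regfr n (k' + 1) (p \<circ> f) (a \<circ> f)"
    using w by (intro regfr_reindex[OF _ ran last sums]) auto
  then have reg: "regfr n (k' + 1) (p \<circ> f) (a \<circ> \<pi>)"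
    using regfr_cong[of "k' + 1" "a \<circ> f" "a \<circ> \<pi>"] \<pi>f by simp
  have nov: "sum (p \<circ> f) {1..k'+1} + sum q {1..l+1} \<le> n"
    using w sum_reindex_blocks[OF last sums] by simp
  have rev: "revregfr n (l + 1) q y" using w by simp
  have "k' > 0"
  proof (rule ccontr)
    assume "\<not> k' > 0"
    then have "ip ((a \<circ> f) (k' + 1)) (y (l + 1)) = 0"
      by (intro regfr_orthogonal_revregfr[OF reg_f rev nov]) auto
    then show False using last w by auto
  qed
  moreover have "(c \<circ> \<pi>) i = 0" if "i \<in> {1..k'}" for i
    using that \<pi>f w subsetD[OF ran imageI[OF that]] by simp
  moreover have "(c \<circ> \<pi>) (k' + 1) = -1" using \<pi>f last w by simp
  ultimately have "nonoverlapping_witness m n (a \<circ> \<pi>) (c \<circ> \<pi>) k' l (p \<circ> f) q y"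
    unfolding nonoverlapping_witness_def using w k' reg nov rev in_m by simp
  then have "possible_output m n (a \<circ> \<pi>) (c \<circ> \<pi>)"
    using possible_output_if_witness[OF sdp_instance_permute[OF inst \<pi>]] pos by simp
  then show ?thesis using \<pi> by blast
qed

theorem theorem9:
  shows
    "(\<forall>m n k l p q s ijs ij ijs' t.
        alg_params m n k l p q \<and> alg_init n k l p q s \<and>
        alg_loop k l = ijs @ ij # ijs' \<and> star_run n k l p q ijs s t \<longrightarrow>
        (\<exists>t'. star_step n k l p q ij t t')) \<and>
     (\<forall>m n a c. possible_output m n a c \<longrightarrow> nonoverlapping_weakly_infeasible m n a c) \<and>
     (\<forall>m n a c k l p q y.
        sdp_instance m n a c \<and> nonoverlapping_witness m n a c k l p q y \<and> (\<forall>i\<in>{1..k}. p i > 0) \<longrightarrow>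
        possible_output m n a c) \<and>
     (\<forall>m n a c. nonoverlapping_weakly_infeasible m n a c \<longrightarrow>
        (\<exists>\<pi>. \<pi> permutes {1..m} \<and> possible_output m n (a \<circ> \<pi>) (c \<circ> \<pi>)))"
proof (intro conjI allI impI; (elim conjE)?)
  fix m n k l p q s ijs ij ijs' t
  assume par: "alg_params m n k l p q" and s: "alg_init n k l p q s"
    and loop: "alg_loop k l = ijs @ ij # ijs'" and run: "star_run n k l p q ijs s t"
  have "set (ijs @ ij # ijs') = {2..k+1} \<times> {2..l+1}"
    using set_alg_loop[of k l] loop by simp
  then have "set ijs \<subseteq> {2..k+1} \<times> {2..l+1}" "ij \<in> {2..k+1} \<times> {2..l+1}"
    by auto
  then show "\<exists>t'. star_step n k l p q ij t t'"
    using star_step_solvable[OF par] star_run_alg_init[OF run s] by blast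
next
  fix m n a c assume "possible_output m n a c"
  then show "nonoverlapping_weakly_infeasible m n a c"
    by (rule possible_output_nonoverlapping_weakly_infeasible)
next
  fix m n a c k l p q y
  assume "sdp_instance m n a c" "nonoverlapping_witness m n a c k l p q y" "\<forall>i\<in>{1..k}. p i > 0"
  then show "possible_output m n a c" by (rule possible_output_if_witness)
next
  fix m n a c assume "nonoverlapping_weakly_infeasible m n a c"
  then show "\<exists>\<pi>. \<pi> permutes {1..m} \<and> possible_output m n (a \<circ> \<pi>) (c \<circ> \<pi>)"
    by (rule possible_output_up_to_order)
qed

end
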